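(* For $p>0$ let $\mathscr{E}^{clf}_{cbf,2}=\mathscr{E}^{clf}_{cbf,2}(p)$ be the set defined in the context. Let $x_{eq}\in\mathbb{R}^n$ and assume the following three conditions hold: (i) $x_{eq}\in\mathscr{E}^{clf}_{cbf,2}(p)$ for some $p>0$; (ii) $\nabla V(x_{eq})=k\,\nabla h(x_{eq})$ for some $k>0$; (iii) $L_fh(x_{eq})\le0$. Then $x_{eq}\in\mathscr{E}^{clf}_{cbf,2}(p)$ for every $p>0$.
   Context: Setting: $\dot x=f(x)+g(x)u$, $x\in\mathbb{R}^n$, $u\in\mathbb{R}^m$, with $f:\mathbb{R}^n\to\mathbb{R}^n$ and $g:\mathbb{R}^n\to\mathbb{R}^{n\times m}$ locally Lipschitz. For a differentiable $\phi:\mathbb{R}^n\to\mathbb{R}$, $L_f\phi=\nabla\phi^\top f\in\mathbb{R}$ and $L_g\phi=\nabla\phi^\top g\in\mathbb{R}^{1\times m}$. $V:\mathbb{R}^n\to\mathbb{R}$ is a control Lyapunov function (CLF): $V$ is smooth and positive definite ($V(0)=0$, $V(x)>0$ for $x\ne0$), and $\inf_{u\in\mathbb{R}^m}[L_fV(x)+L_gV(x)u]\le-\gamma(V(x))$ for all $x\in\mathbb{R}^n$, where $\gamma:\mathbb{R}_{\ge0}\to\mathbb{R}_{\ge0}$ is class $\mathcal{K}$ (continuous, strictly increasing, $\gamma(0)=0$). $h:\mathbb{R}^n\to\mathbb{R}$ is a control barrier function (CBF): $h$ is smooth and $\sup_{u\in\mathbb{R}^m}[L_fh(x)+L_gh(x)u+\alpha(h(x))]\ge0$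 for all $x\in\mathbb{R}^n$, where $\alpha:\mathbb{R}\to\mathbb{R}$ is a locally Lipschitz extended class $\mathcal{K}$ function (continuous, strictly increasing, $\alpha(0)=0$). The safety set is $\mathscr{C}=\{x: h(x)\ge0\}$, with $\mathrm{Int}(\mathscr{C})=\{x:h(x)>0\}$ and $\partial\mathscr{C}=\{x:h(x)=0\}$. The origin is in $\mathrm{Int}(\mathscr{C})$. Notation (all functions evaluated at $x$, for given $p>0$): $F_V=L_fV+\gamma(V)$, $F_h=L_fh+\alpha(h)$, $\Omega^{clf}_{cbf,2}=\{x: F_VL_ghL_gh^\top-F_hL_gVL_gh^\top\ge0,\ F_VL_gVL_gh^\top-F_h(1/p+L_gVL_gV^\top)\ge0,\ L_gh\ne0\}$, $\Delta=(1/p+L_gVL_gV^\top)L_ghL_gh^\top-(L_gVL_gh^\top)^2$ (which is positive when $L_gh\ne0$), $\lambda_1=\Delta^{-1}(F_VL_ghL_gh^\top-F_hL_gVL_gh^\top)$, $\lambda_2=\Delta^{-1}(F_VL_gVL_gh^\top-F_h(1/p+L_gVL_gV^\top))$, $\mathscr{E}^{clf}_{cbf,2}(p)=\{x\in\Omega^{clf}_{cbf,2}\cap\partial\mathscr{C}: f=\lambda_1\,g\,L_gV^\top-\lambda_2\,g\,L_gh^\top\}$. (This is the set of boundary equilibria with $L_gh\neq 0$ of the closed-loop system $\dot x=f+gu^\star$, where $u^\star(x)$ minimizes $\frac12\|u\|^2+\frac12p\delta^2$ over $(u,\delta)$ subject to $L_fV+L_gVu+\gamma(V)\le\delta$ and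 $L_fh+L_ghu+\alpha(h)\ge0$.) *)

theory Defs
  imports "HOL-Analysis.Analysis"
begin

section \<open>Gradients, smoothness, Lie derivatives\<close>

definition gradient :: "(real^'n \<Rightarrow> real) \<Rightarrow> real^'n \<Rightarrow> real^'n" where
  "gradient \<phi> x = (THE D. GDERIV \<phi> x :> D)"

lemma gradient_eqI:
  assumes "GDERIV \<phi> x :> D"
  shows "gradient \<phi> x = D"
  unfolding gradient_def
proof (rule the_equality)
  fix D' assume "GDERIV \<phi> x :> D'"
  with assms have "(\<lambda>v. inner v D) = (\<lambda>v. inner v D')"
    unfolding gderiv_def by (rule has_derivative_unique)
  then have "\<forall>v. v \<bullet> D' = v \<bullet> D"
    by (simp add: fun_eq_iff)
  then show "D' = D"
    by (simp only: vector_eq_ldot)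
qed (fact assms)

text \<open>\<open>C_diff k \<phi>\<close>: \<open>\<phi>\<close> is of class \<open>C\<^sup>k\<close> on the whole space; the
  components of the gradient are the partial derivatives.\<close>

primrec C_diff :: "nat \<Rightarrow> (real^'n \<Rightarrow> real) \<Rightarrow> bool" where
  "C_diff 0 \<phi> \<longleftrightarrow> continuous_on UNIV \<phi>"
| "C_diff (Suc k) \<phi> \<longleftrightarrow>
     (\<forall>x. \<phi> differentiable (at x)) \<and> (\<forall>i. C_diff k (\<lambda>x. gradient \<phi> x $ i))"

definition smooth :: "(real^'n \<Rightarrow> real) \<Rightarrow> bool" where
  "smooth \<phi> \<longleftrightarrow> (\<forall>k. C_diff k \<phi>)"

text \<open>The library notion is for time-dependent maps; here the dependence on time is constant.\<close>

definition locally_lipschitz :: "('a::metric_space \<Rightarrow> 'b::metric_space) \<Rightarrow> bool" where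
  "locally_lipschitz F \<longleftrightarrow> local_lipschitz (UNIV :: real set) UNIV (\<lambda>_. F)"

definition lie_f :: "(real^'n \<Rightarrow> real^'n) \<Rightarrow> (real^'n \<Rightarrow> real) \<Rightarrow> real^'n \<Rightarrow> real" where
  "lie_f f \<phi> x = gradient \<phi> x \<bullet> f x"

text \<open>The row vector \<open>L\<^sub>g\<phi> = \<nabla>\<phi>\<^sup>T g\<close> is represented as an element of \<open>real^'m\<close>.
  Hence \<open>L\<^sub>g\<phi> u\<close> and \<open>L\<^sub>g\<phi> (L\<^sub>g\<psi>)\<^sup>T\<close> become inner products, and \<open>g (L\<^sub>g\<phi>)\<^sup>T\<close>
  becomes a matrix-vector product.\<close>

definition lie_g :: "(real^'n \<Rightarrow> real^'m^'n) \<Rightarrow> (real^'n \<Rightarrow> real) \<Rightarrow> real^'n \<Rightarrow> real^'m" where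
  "lie_g g \<phi> x = gradient \<phi> x v* g x"

section \<open>Control Lyapunov and control barrier functions\<close>

definition class_K :: "(real \<Rightarrow> real) \<Rightarrow> bool" where
  "class_K \<gamma> \<longleftrightarrow> continuous_on {0..} \<gamma> \<and> strict_mono_on {0..} \<gamma> \<and> \<gamma> 0 = 0"

definition extended_class_K :: "(real \<Rightarrow> real) \<Rightarrow> bool" where
  "extended_class_K \<alpha> \<longleftrightarrow> continuous_on UNIV \<alpha> \<and> strict_mono \<alpha> \<and> \<alpha> 0 = 0"

definition positive_definite :: "(real^'n \<Rightarrow> real) \<Rightarrow> bool" where
  "positive_definite V \<longleftrightarrow> V 0 = 0 \<and> (\<forall>x. x \<noteq> 0 \<longrightarrow> V x > 0)"

text \<open>The infimum and the supremum over the unbounded input space may be infinite, so they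
  are taken in \<open>ereal\<close>.\<close>

definition control_lyapunov ::
  "(real^'n \<Rightarrow> real^'n) \<Rightarrow> (real^'n \<Rightarrow> real^'m^'n) \<Rightarrow> (real \<Rightarrow> real) \<Rightarrow> (real^'n \<Rightarrow> real) \<Rightarrow> bool"
where
  "control_lyapunov f g \<gamma> V \<longleftrightarrow>
     class_K \<gamma> \<and> smooth V \<and> positive_definite V \<and>
     (\<forall>x. (INF u. ereal (lie_f f V x + lie_g g V x \<bullet> u)) \<le> ereal (- \<gamma> (V x)))"

definition control_barrier ::
  "(real^'n \<Rightarrow> real^'n) \<Rightarrow> (real^'n \<Rightarrow> real^'m^'n) \<Rightarrow> (real \<Rightarrow> real) \<Rightarrow> (real^'n \<Rightarrow> real) \<Rightarrow> bool"
where
  "control_barrier f g \<alpha> h \<longleftrightarrow>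
     extended_class_K \<alpha> \<and> locally_lipschitz \<alpha> \<and> smooth h \<and>
     (\<forall>x. (SUP u. ereal (lie_f f h x + lie_g g h x \<bullet> u + \<alpha> (h x))) \<ge> 0)"

text \<open>Interior and boundary of the safety set \<open>{x. h x \<ge> 0}\<close> are, by convention, given by
  the sign of \<open>h\<close>; they need not coincide with its topological interior and frontier.\<close>

definition safe_interior :: "(real^'n \<Rightarrow> real) \<Rightarrow> (real^'n) set" where
  "safe_interior h = {x. h x > 0}"

definition safe_boundary :: "(real^'n \<Rightarrow> real) \<Rightarrow> (real^'n) set" where
  "safe_boundary h = {x. h x = 0}"

section \<open>Boundary equilibria of the closed loop\<close>

definition F_V ::
  "(real^'n \<Rightarrow> real^'n) \<Rightarrow> (real \<Rightarrow> real) \<Rightarrow> (real^'n \<Rightarrow> real) \<Rightarrow> real^'n \<Rightarrow> real" where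
  "F_V f \<gamma> V x = lie_f f V x + \<gamma> (V x)"

definition F_h ::
  "(real^'n \<Rightarrow> real^'n) \<Rightarrow> (real \<Rightarrow> real) \<Rightarrow> (real^'n \<Rightarrow> real) \<Rightarrow> real^'n \<Rightarrow> real" where
  "F_h f \<alpha> h x = lie_f f h x + \<alpha> (h x)"

definition Omega_clf_cbf2 ::
  "(real^'n \<Rightarrow> real^'n) \<Rightarrow> (real^'n \<Rightarrow> real^'m^'n) \<Rightarrow> (real \<Rightarrow> real) \<Rightarrow> (real \<Rightarrow> real) \<Rightarrow>
   (real^'n \<Rightarrow> real) \<Rightarrow> (real^'n \<Rightarrow> real) \<Rightarrow> real \<Rightarrow> (real^'n) set"
where
  "Omega_clf_cbf2 f g \<gamma> \<alpha> V h p = {x.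
     F_V f \<gamma> V x * (lie_g g h x \<bullet> lie_g g h x) - F_h f \<alpha> h x * (lie_g g V x \<bullet> lie_g g h x) \<ge> 0 \<and>
     F_V f \<gamma> V x * (lie_g g V x \<bullet> lie_g g h x)
       - F_h f \<alpha> h x * (1 / p + lie_g g V x \<bullet> lie_g g V x) \<ge> 0 \<and>
     lie_g g h x \<noteq> 0}"

definition Delta ::
  "(real^'n \<Rightarrow> real^'m^'n) \<Rightarrow> (real^'n \<Rightarrow> real) \<Rightarrow> (real^'n \<Rightarrow> real) \<Rightarrow> real \<Rightarrow> real^'n \<Rightarrow> real"
where
  "Delta g V h p x =
     (1 / p + lie_g g V x \<bullet> lie_g g V x) * (lie_g g h x \<bullet> lie_g g h x)
       - (lie_g g V x \<bullet> lie_g g h x)\<^sup>2"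

definition lambda1 ::
  "(real^'n \<Rightarrow> real^'n) \<Rightarrow> (real^'n \<Rightarrow> real^'m^'n) \<Rightarrow> (real \<Rightarrow> real) \<Rightarrow> (real \<Rightarrow> real) \<Rightarrow>
   (real^'n \<Rightarrow> real) \<Rightarrow> (real^'n \<Rightarrow> real) \<Rightarrow> real \<Rightarrow> real^'n \<Rightarrow> real"
where
  "lambda1 f g \<gamma> \<alpha> V h p x = inverse (Delta g V h p x) *
     (F_V f \<gamma> V x * (lie_g g h x \<bullet> lie_g g h x) - F_h f \<alpha> h x * (lie_g g V x \<bullet> lie_g g h x))"

definition lambda2 ::
  "(real^'n \<Rightarrow> real^'n) \<Rightarrow> (real^'n \<Rightarrow> real^'m^'n) \<Rightarrow> (real \<Rightarrow> real) \<Rightarrow> (real \<Rightarrow> real) \<Rightarrow>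
   (real^'n \<Rightarrow> real) \<Rightarrow> (real^'n \<Rightarrow> real) \<Rightarrow> real \<Rightarrow> real^'n \<Rightarrow> real"
where
  "lambda2 f g \<gamma> \<alpha> V h p x = inverse (Delta g V h p x) *
     (F_V f \<gamma> V x * (lie_g g V x \<bullet> lie_g g h x)
       - F_h f \<alpha> h x * (1 / p + lie_g g V x \<bullet> lie_g g V x))"

definition E_clf_cbf2 ::
  "(real^'n \<Rightarrow> real^'n) \<Rightarrow> (real^'n \<Rightarrow> real^'m^'n) \<Rightarrow> (real \<Rightarrow> real) \<Rightarrow> (real \<Rightarrow> real) \<Rightarrow>
   (real^'n \<Rightarrow> real) \<Rightarrow> (real^'n \<Rightarrow> real) \<Rightarrow> real \<Rightarrow> (real^'n) set"
where
  "E_clf_cbf2 f g \<gamma> \<alpha> V h p = {x \<in> Omega_clf_cbf2 f g \<gamma> \<alpha> V h p \<inter> safe_boundary h.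
     f x = lambda1 f g \<gamma> \<alpha> V h p x *\<^sub>R (g x *v lie_g g V x)
         - lambda2 f g \<gamma> \<alpha> V h p x *\<^sub>R (g x *v lie_g g h x)}"

end

theory Submission
  imports Defs
begin

text \<open>
  On the boundary, \<open>\<alpha>(h) = 0\<close>. If moreover \<open>\<nabla>V = k \<nabla>h\<close>, then \<open>L\<^sub>gV = k L\<^sub>gh\<close> and \<open>L\<^sub>fV = k L\<^sub>fh\<close>,
  so that \<open>\<Delta> = \<bar>L\<^sub>gh\<bar>\<^sup>2 / p\<close>, \<open>\<lambda>\<^sub>1 = p \<gamma>(V)\<close> and \<open>\<lambda>\<^sub>2 = k \<lambda>\<^sub>1 - L\<^sub>fh / \<bar>L\<^sub>gh\<bar>\<^sup>2\<close>. The terms with \<open>\<lambda>\<^sub>1\<close> cancel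
  in the equilibrium equation, which no longer depends on \<open>p\<close>. The parameter remains only in the
  condition \<open>k \<gamma>(V) \<bar>L\<^sub>gh\<bar>\<^sup>2 - L\<^sub>fh / p \<ge> 0\<close>, which holds for all \<open>p > 0\<close> because \<open>L\<^sub>fh \<le> 0\<close>.
\<close>

lemma E_clf_cbf2_collinear_iff:
  assumes grad: "gradient V x = k *\<^sub>R gradient h x"
    and "\<alpha> 0 = 0" "p > 0"
  shows "x \<in> E_clf_cbf2 f g \<gamma> \<alpha> V h p \<longleftrightarrow>
    h x = 0 \<and> lie_g g h x \<noteq> 0 \<and> \<gamma> (V x) \<ge> 0 \<and>
    k * \<gamma> (V x) * (lie_g g h x \<bullet> lie_g g h x) - lie_f f h x / p \<ge> 0 \<and>
    f x = (lie_f f h x / (lie_g g h x \<bullet> lie_g g h x)) *\<^sub>R (g x *v lie_g g h x)"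
\<comment> \<open>Both sides demand this condition; where it holds, \<open>s > 0\<close> and
  division by \<open>s\<close> is legitimate.\<close>
proof (cases "h x = 0 \<and> lie_g g h x \<noteq> 0")
  case False
  then show ?thesis
    by (auto simp: E_clf_cbf2_def Omega_clf_cbf2_def safe_boundary_def)
next
  case True
  define b where "b = lie_g g h x"
  define s where "s = b \<bullet> b"
  define c where "c = lie_f f h x"
  define G where "G = \<gamma> (V x)"
  have s: "s > 0"
    using True by (simp add: s_def b_def)
  have LgV: "lie_g g V x = k *\<^sub>R b"
    by (simp add: lie_g_def b_def grad scaleR_vector_matrix_assoc)
  have FV: "F_V f \<gamma> V x = k * c + G"
    by (simp add: F_V_def lie_f_def grad c_def G_def)
  have Fh: "F_h f \<alpha> h x = c"
    using True \<open>\<alpha> 0 = 0\<close> by (simp add: F_h_def c_def)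
  have first: "F_V f \<gamma> V x * s - F_h f \<alpha> h x * (lie_g g V x \<bullet> b) = s * G"
    by (simp add: FV Fh LgV s_def algebra_simps)
  have second: "F_V f \<gamma> V x * (lie_g g V x \<bullet> b)
      - F_h f \<alpha> h x * (1 / p + lie_g g V x \<bullet> lie_g g V x) = k * G * s - c / p"
    by (simp add: FV Fh LgV s_def algebra_simps)
  \<comment> \<open>Parallel vectors give equality in Cauchy-Schwarz, so only the
    \<open>1 / p\<close> term survives.\<close>
  have Delta: "Delta g V h p x = s / p"
    by (simp add: Delta_def LgV s_def flip: b_def) (simp add: algebra_simps power2_eq_square)
  have l1: "lambda1 f g \<gamma> \<alpha> V h p x = p * G"
    using s by (simp add: lambda1_def Delta first flip: b_def s_def)
  have l2: "lambda2 f g \<gamma> \<alpha> V h p x = k * (p * G) - c / s"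
    using s \<open>p > 0\<close> by (simp add: lambda2_def Delta second flip: b_def) (simp add: field_simps)
  have "lambda1 f g \<gamma> \<alpha> V h p x *\<^sub>R (g x *v lie_g g V x)
      - lambda2 f g \<gamma> \<alpha> V h p x *\<^sub>R (g x *v b) = (c / s) *\<^sub>R (g x *v b)"
    by (simp add: l1 l2 LgV matrix_vector_mult_scaleR algebra_simps)
  \<comment> \<open>The first inequality is now \<open>s * G \<ge> 0\<close>, that is,
    \<open>G \<ge> 0\<close> since \<open>s > 0\<close>.\<close>
  then show ?thesis
    using True s
    unfolding E_clf_cbf2_def Omega_clf_cbf2_def safe_boundary_def mem_Collect_eq Int_iff
      b_def[symmetric] c_def[symmetric] G_def[symmetric] first second s_def[symmetric]
    by (auto simp: zero_le_mult_iff)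
qed

theorem proposition3:
  fixes f :: "real^'n \<Rightarrow> real^'n"
    and g :: "real^'n \<Rightarrow> real^'m^'n"
    and V h :: "real^'n \<Rightarrow> real"
    and \<gamma> \<alpha> :: "real \<Rightarrow> real"
    and x_eq :: "real^'n"
  assumes "locally_lipschitz f"
    and "locally_lipschitz g"
    and "control_lyapunov f g \<gamma> V"
    and "control_barrier f g \<alpha> h"
    and "0 \<in> safe_interior h"
    and "\<exists>p>0. x_eq \<in> E_clf_cbf2 f g \<gamma> \<alpha> V h p"
    and "\<exists>k>0. gradient V x_eq = k *\<^sub>R gradient h x_eq"
    and "lie_f f h x_eq \<le> 0"
  shows "\<forall>p>0. x_eq \<in> E_clf_cbf2 f g \<gamma> \<alpha> V h p"
proof (intro allI impI)
  fix p :: real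
  assume p: "p > 0"
  obtain q where q: "q > 0" "x_eq \<in> E_clf_cbf2 f g \<gamma> \<alpha> V h q"
    using assms(6) by blast
  obtain k where k: "k > 0" and grad: "gradient V x_eq = k *\<^sub>R gradient h x_eq"
    using assms(7) by blast
  have \<alpha>: "\<alpha> 0 = 0"
    using assms(4) by (simp add: control_barrier_def extended_class_K_def)
  note collinear = E_clf_cbf2_collinear_iff[where \<alpha> = \<alpha>, OF grad \<alpha>]
  \<comment> \<open>These conditions are free of the parameter, so they carry over from
    \<open>q\<close> to \<open>p\<close>.\<close>
  have eq: "h x_eq = 0" "lie_g g h x_eq \<noteq> 0" "\<gamma> (V x_eq) \<ge> 0"
    "f x_eq = (lie_f f h x_eq / (lie_g g h x_eq \<bullet> lie_g g h x_eq)) *\<^sub>R (g x_eq *v lie_g g h x_eq)"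
    using q(2) unfolding collinear[OF q(1)] by blast+
  have "lie_f f h x_eq / p \<le> 0"
    using assms(8) p by (simp add: divide_nonpos_pos)
  moreover have "k * \<gamma> (V x_eq) * (lie_g g h x_eq \<bullet> lie_g g h x_eq) \<ge> 0"
    using k eq(3) by simp
  ultimately show "x_eq \<in> E_clf_cbf2 f g \<gamma> \<alpha> V h p"
    unfolding collinear[OF p] using eq by linarith
qed

end
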